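(* Let $v>k>i\ge 0$ be integers with $v\ge 2k$ and $(v,k,i)\neq(2k,k,0)$, and let $X=J(v,k,i)$. Then the girth of $X$ is $$g(X)= \begin{cases} 3 & \text{if } v\geq 3(k-i); \\ 4 & \text{if } v<3(k-i) \text{ and } (v,k,i)\neq (2k+1,k,0); \\ 5 & \text{if } (v,k,i)=(5,2,0); \\ 6 & \text{if } (v,k,i)=(2k+1,k,0) \text{ and } k>2. \end{cases}$$
   Context: For integers $v>k>i\ge 0$, the generalized Johnson graph $J(v,k,i)$ is the simple undirected graph whose vertices are the $k$-element subsets of a fixed $v$-element set, two vertices $A,B$ being adjacent iff $|A\cap B|=i$. The girth is the length of a shortest cycle. *)

theory Defs
  imports "Graph_Theory.Pair_Digraph" "HOL-Library.Extended_Nat"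
begin

text \<open>
  Simple undirected graphs are represented, as in the Graph Theory entry, by symmetric loop-free
  digraphs without parallel arcs (locale \<open>pair_graph\<close>): each edge is a pair of opposite arcs.
\<close>

definition generalized_johnson_graph :: "'a set \<Rightarrow> nat \<Rightarrow> nat \<Rightarrow> 'a set pair_pre_digraph" where
  "generalized_johnson_graph S k i =
     \<lparr> pverts = {A. A \<subseteq> S \<and> card A = k},
       parcs = {(A, B). A \<subseteq> S \<and> card A = k \<and> B \<subseteq> S \<and> card B = k \<and> card (A \<inter> B) = i} \<rparr>"

lemma pair_graph_generalized_johnson_graph:
  assumes "finite S" "i < k"
  shows "pair_graph (generalized_johnson_graph S k i)"
proof -
  let ?G = "generalized_johnson_graph S k i"
  have V: "finite (pverts ?G)"
    by (rule finite_subset[of _ "Pow S"])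
      (auto simp: generalized_johnson_graph_def assms(1))
  have E: "parcs ?G \<subseteq> pverts ?G \<times> pverts ?G"
    by (auto simp: generalized_johnson_graph_def)
  have fin: "finite (parcs ?G)"
    using finite_subset[OF E finite_cartesian_product[OF V V]] .
  have sym: "symmetric (with_proj ?G)"
    unfolding symmetric_def with_proj_simps
    by (rule symI) (simp add: generalized_johnson_graph_def Int_commute)
  have irrefl: "(A, A) \<notin> parcs ?G" for A
    using assms(2) by (simp add: generalized_johnson_graph_def)
  show ?thesis
  proof
    fix e assume e: "e \<in> parcs ?G"
    show "fst e \<noteq> snd e"
      using e irrefl by (metis prod.collapse)
    show "fst e \<in> pverts ?G" "snd e \<in> pverts ?G"
      using e E by (metis mem_Times_iff subsetD)+
  qed (fact V fin sym)+
qed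

text \<open>
  In the digraph representation, traversing one edge back and forth counts as a library
  \<open>cycle\<close> of length 2. In a simple graph these are the only library cycles of length less
  than 3, so the cycles of the undirected graph are those of length at least 3.
  A graph without cycles has girth \<open>\<infinity>\<close>, the infimum of the empty set.
\<close>

definition girth :: "'a pair_pre_digraph \<Rightarrow> enat" where
  "girth G = (INF p \<in> {p. pre_digraph.cycle (with_proj G) p \<and> 3 \<le> length p}. enat (length p))"

end

theory Submission
  imports Defs
begin

text \<open>
  Triangle-freeness for \<open>v < 3 * (k - i)\<close> is inclusion-exclusion. Let \<open>v = 2 * k + 1\<close> and \<open>i = 0\<close>.
  The union of two distinct vertices has at least \<open>k + 1\<close> elements, so its complement contains at
  most one vertex, and there is no 4-cycle. Two vertices with a common neighbour lie in its
  complement, which has \<open>k + 1\<close> elements, so they share at least \<open>k - 1\<close> elements. In a pentagon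
  \<open>A, B, C, D, E\<close> the disjoint sets \<open>A\<close> and \<open>E\<close> therefore both meet \<open>C\<close> in at least \<open>k - 1\<close>
  elements, which forces \<open>k \<le> 2\<close>.
\<close>

section \<open>Cycles as cyclic lists of vertices\<close>

lemma pcas_iff_map: "pcas u p w \<longleftrightarrow> map fst p @ [w] = u # map snd p"
  by (induction p arbitrary: u) (auto simp: eq_commute)

lemma pawalk_verts_eq_map: "pcas u p w \<Longrightarrow> pawalk_verts u p = map fst p @ [w]"
  by (induction p arbitrary: u) auto

text \<open>Here \<open>zip xs (rotate1 xs)\<close> pairs each vertex with its cyclic successor,
  including the closing arc from the last vertex to the first. For an explicit list, the simplifier
  turns this into finitely many adjacencies. Lists shorter than 3 are not excluded, so length bounds
  are stated separately.\<close>

definition polygon :: "'a pair_pre_digraph \<Rightarrow> 'a list \<Rightarrow> bool" where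
  "polygon G xs \<longleftrightarrow> distinct xs \<and> set (zip xs (rotate1 xs)) \<subseteq> parcs G"

text \<open>In a closed walk the heads of the arcs are the tails rotated by one place, so the tails
  determine the walk. The library asks for distinctness of the visited vertices without the starting
  one. These are the heads, and rotation carries distinctness over to the tails.\<close>

lemma cycle_iff_polygon:
  assumes "pair_wf_digraph G"
  shows "pre_digraph.cycle (with_proj G) p \<longleftrightarrow>
    (\<exists>xs. xs \<noteq> [] \<and> polygon G xs \<and> p = zip xs (rotate1 xs))"
proof
  assume "pre_digraph.cycle (with_proj G) p"
  then obtain u where u: "set p \<subseteq> parcs G" "pcas u p u" "distinct (tl (pawalk_verts u p))" "p \<noteq> []"
    by (auto simp: pre_digraph.cycle_def pre_digraph.awalk_def cas_with_proj_eq awalk_verts_with_proj_eq)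
  have eq: "map fst p @ [u] = u # map snd p"
    using u(2) by (simp add: pcas_iff_map)
  then have rot: "rotate1 (map fst p) = map snd p"
    using u(4) by (cases p) auto
  have "distinct (map snd p)"
    using u(3) eq by (simp add: pawalk_verts_eq_map[OF u(2)])
  then have "distinct (map fst p)"
    by (metis rot distinct1_rotate)
  moreover have "p = zip (map fst p) (map snd p)"
    by (simp add: zip_map_fst_snd)
  ultimately show "\<exists>xs. xs \<noteq> [] \<and> polygon G xs \<and> p = zip xs (rotate1 xs)"
    using u rot unfolding polygon_def by (metis map_is_Nil_conv)
next
  assume "\<exists>xs. xs \<noteq> [] \<and> polygon G xs \<and> p = zip xs (rotate1 xs)"
  then obtain xs where xs: "xs \<noteq> []" "distinct xs" "set p \<subseteq> parcs G" "p = zip xs (rotate1 xs)"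
    by (auto simp: polygon_def)
  have maps: "map fst p = xs" "map snd p = rotate1 xs"
    by (simp_all add: xs(4))
  have cas: "pcas (hd xs) p (hd xs)"
    unfolding pcas_iff_map maps using xs(1) by (cases xs) auto
  have "p \<noteq> []"
    using xs(1) maps(1) by auto
  then have "hd p \<in> parcs G" "fst (hd p) = hd xs"
    using xs(3) maps(1) by (auto simp: hd_map)
  then have "hd xs \<in> pverts G"
    using pair_wf_digraph.arc_fst_in_verts[OF assms] by (metis prod.collapse)
  moreover have "distinct (tl (pawalk_verts (hd xs) p))"
    using xs(1,2) unfolding pawalk_verts_eq_map[OF cas] maps by (cases xs) auto
  ultimately show "pre_digraph.cycle (with_proj G) p"
    using cas xs(3) \<open>p \<noteq> []\<close> by (auto simp: pre_digraph.cycle_def pre_digraph.awalk_def cas_with_proj_eq awalk_verts_with_proj_eq)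
qed

text \<open>Separates the computation of an infimum over walks from the combinatorics: each girth
  below comes from one explicit polygon and the exclusion of shorter ones.\<close>

lemma girth_eqI:
  assumes "pair_wf_digraph G"
    and cyc: "polygon G xs" "length xs = n" "3 \<le> n"
    and min: "\<And>ys. polygon G ys \<Longrightarrow> 3 \<le> length ys \<Longrightarrow> length ys < n \<Longrightarrow> False"
  shows "girth G = enat n"
  unfolding girth_def
proof (rule antisym)
  have "pre_digraph.cycle (with_proj G) (zip xs (rotate1 xs))"
    using cyc cycle_iff_polygon[OF assms(1)] by fastforce
  then show "(INF p\<in>{p. pre_digraph.cycle (with_proj G) p \<and> 3 \<le> length p}. enat (length p)) \<le> enat n"
    using cyc by (intro INF_lower2[where i = "zip xs (rotate1 xs)"]) auto
  show "enat n \<le> (INF p\<in>{p. pre_digraph.cycle (with_proj G) p \<and> 3 \<le> length p}. enat (length p))"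
    using min by (intro INF_greatest) (force simp: cycle_iff_polygon[OF assms(1)] not_less[symmetric])
qed

section \<open>Short lists and subsets of equal size\<close>

lemma length_3_cases:
  assumes "length xs = 3"
  obtains a b c where "xs = [a, b, c]"
  using assms by (auto simp: numeral_eq_Suc length_Suc_conv)

lemma length_4_cases:
  assumes "length xs = 4"
  obtains a b c d where "xs = [a, b, c, d]"
  using assms by (auto simp: numeral_eq_Suc length_Suc_conv)

lemma length_5_cases:
  assumes "length xs = 5"
  obtains a b c d e where "xs = [a, b, c, d, e]"
  using assms by (auto simp: numeral_eq_Suc length_Suc_conv)

text \<open>Exchange one element of a first subset for an element outside it; both exist because
  \<open>0 < n < card X\<close>.\<close>

lemma obtain_two_subsets:
  assumes "0 < n" "n < card X"
  obtains P Q where "P \<subseteq> X" "Q \<subseteq> X" "card P = n" "card Q = n" "P \<noteq> Q"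
proof -
  have fin: "finite X"
    using assms card.infinite by fastforce
  obtain P where P: "P \<subseteq> X" "card P = n" "finite P"
    using obtain_subset_with_card_n assms(2) by (metis less_imp_le)
  obtain p where p: "p \<in> P"
    using assms(1) P(2) by fastforce
  obtain q where q: "q \<in> X" "q \<notin> P"
    using assms(2) P by (metis less_irrefl subsetI subset_antisym)
  show thesis
  proof (rule that[of P "insert q (P - {p})"])
    show "card (insert q (P - {p})) = n"
      using P p q assms(1) by simp
    show "P \<noteq> insert q (P - {p})"
      using q by blast
  qed (use P q in auto)
qed

section \<open>Generalized Johnson graphs: triangles, 4-cycles, girth 3 and 4\<close>

locale johnson =
  fixes S :: "'a set" and k i :: nat
  assumes finite_S: "finite S" and i_less_k: "i < k"
begin

abbreviation J :: "'a set pair_pre_digraph" where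
  "J \<equiv> generalized_johnson_graph S k i"

definition vertex :: "'a set \<Rightarrow> bool" where
  "vertex A \<longleftrightarrow> A \<subseteq> S \<and> card A = k"

lemma arc_iff: "(A, B) \<in> parcs J \<longleftrightarrow> vertex A \<and> vertex B \<and> card (A \<inter> B) = i"
  by (auto simp: generalized_johnson_graph_def vertex_def)

lemma vertex_finite: "vertex A \<Longrightarrow> finite A"
  unfolding vertex_def using finite_S finite_subset by blast

lemma arc_irrefl: "vertex A \<Longrightarrow> card (A \<inter> B) = i \<Longrightarrow> A \<noteq> B"
  using i_less_k by (auto simp: vertex_def)

lemma pair_wf_digraph_J: "pair_wf_digraph J"
proof -
  interpret pair_graph J
    using finite_S i_less_k by (rule pair_graph_generalized_johnson_graph)
  show ?thesis by unfold_locales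
qed

lemmas girth_J_eqI = girth_eqI[OF pair_wf_digraph_J]

lemma polygon_J_3_iff:
  "polygon J [A, B, C] \<longleftrightarrow> vertex A \<and> vertex B \<and> vertex C \<and>
    card (A \<inter> B) = i \<and> card (B \<inter> C) = i \<and> card (C \<inter> A) = i"
  using arc_irrefl[of A B] arc_irrefl[of B C] arc_irrefl[of C A]
  by (auto simp: polygon_def arc_iff)

text \<open>Adjacent vertices differ because \<open>i < k\<close>, so only the two diagonals leave a
  distinctness condition.\<close>

lemma polygon_J_4_iff:
  "polygon J [A, B, C, D] \<longleftrightarrow> vertex A \<and> vertex B \<and> vertex C \<and> vertex D \<and> A \<noteq> C \<and> B \<noteq> D \<and>
    card (A \<inter> B) = i \<and> card (B \<inter> C) = i \<and> card (C \<inter> D) = i \<and> card (D \<inter> A) = i"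
  using arc_irrefl[of A B] arc_irrefl[of B C] arc_irrefl[of C D] arc_irrefl[of D A]
  by (auto simp: polygon_def arc_iff)

text \<open>Two adjacent vertices \<open>A\<close> and \<open>I \<union> Y\<close> share
  \<open>I\<close>. The third takes \<open>W\<close> from \<open>I\<close>, equally many elements
  \<open>P\<close> and \<open>Q\<close> from the two private parts, and fills up with
  \<open>Z\<close> from outside. It then meets either vertex in \<open>card W\<close> plus
  \<open>m\<close> elements, which makes \<open>i\<close>.\<close>

lemma triangle:
  assumes "2 * k \<le> card S" "3 * (k - i) \<le> card S"
  shows "\<exists>xs. polygon J xs \<and> length xs = 3"
proof -
  obtain A where A: "A \<subseteq> S" "card A = k" "finite A"
    using assms(1) obtain_subset_with_card_n[of k S] by auto
  obtain I where I: "I \<subseteq> A" "card I = i" "finite I"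
    using A i_less_k obtain_subset_with_card_n[of i A] by auto
  have "k - i \<le> card (S - A)"
    using A assms(1) finite_S by (simp add: card_Diff_subset)
  then obtain Y where Y: "Y \<subseteq> S - A" "card Y = k - i" "finite Y"
    using obtain_subset_with_card_n by blast
  \<comment> \<open>The largest possible share of the private parts, which have \<open>k - i\<close>
    elements each. A larger \<open>m\<close> leaves fewer elements to be found outside
    \<open>A \<union> Y\<close>.\<close>
  define m where "m = min i (k - i)"
  have "card (A - I) = k - i"
    using A I by (simp add: card_Diff_subset)
  then obtain P where P: "P \<subseteq> A - I" "card P = m" "finite P"
    using obtain_subset_with_card_n[of m "A - I"] by (auto simp: m_def)
  obtain Q where Q: "Q \<subseteq> Y" "card Q = m" "finite Q"
    using Y obtain_subset_with_card_n[of m Y] by (auto simp: m_def)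
  obtain W where W: "W \<subseteq> I" "card W = i - m" "finite W"
    using I obtain_subset_with_card_n[of "i - m" I] by auto
  have "card (A \<union> Y) = k + (k - i)"
    using A Y by (subst card_Un_disjoint) auto
  then have "card (S - (A \<union> Y)) = card S - (k + (k - i))"
    using A Y by (subst card_Diff_subset) auto
  \<comment> \<open>If \<open>m = i\<close>, this is
    \<open>k - 2 * i \<le> card S - (2 * k - i)\<close>, which is the hypothesis
    \<open>3 * (k - i) \<le> card S\<close>. If \<open>m = k - i\<close>, the left side is
    0.\<close>
  then have "k - m - i \<le> card (S - (A \<union> Y))"
    using assms i_less_k by (auto simp: m_def)
  then obtain Z where Z: "Z \<subseteq> S - (A \<union> Y)" "card Z = k - m - i" "finite Z"
    using obtain_subset_with_card_n by blast
  let ?B = "I \<union> Y" and ?C = "(P \<union> W) \<union> (Q \<union> Z)"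
  have "card ?B = k"
    using I Y A i_less_k by (subst card_Un_disjoint) auto
  then have B: "vertex ?B"
    using I A Y by (auto simp: vertex_def)
  have disj: "P \<inter> W = {}" "Q \<inter> W = {}" "Q \<inter> Z = {}" "(P \<union> W) \<inter> (Q \<union> Z) = {}"
    using P W Q Z Y A I by blast+
  then have PW: "card (P \<union> W) = i" and QW: "card (Q \<union> W) = i" and QZ: "card (Q \<union> Z) = k - i"
    using P W Q Z i_less_k by (auto simp: card_Un_disjoint m_def min_def)
  then have "card ?C = k"
    using disj(4) P W Q Z i_less_k by (subst card_Un_disjoint) simp_all
  then have C: "vertex ?C"
    using P W Q Z Y A I by (auto simp: vertex_def)
  have "A \<inter> ?B = I" "?B \<inter> ?C = Q \<union> W" "?C \<inter> A = P \<union> W"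
    using P W Q Z Y A I by blast+
  then have AB: "card (A \<inter> ?B) = i" and BC: "card (?B \<inter> ?C) = i" and CA: "card (?C \<inter> A) = i"
    using I(2) PW QW by simp_all
  have "vertex A"
    using A by (simp add: vertex_def)
  then have "polygon J [A, ?B, ?C]"
    unfolding polygon_J_3_iff using AB BC CA B C by blast
  then show ?thesis
    by (intro exI[of _ "[A, ?B, ?C]"]) simp
qed

text \<open>The union \<open>A \<union> B\<close> has \<open>2 * k - i\<close> elements and
  \<open>C\<close> meets it in at most \<open>2 * i\<close>, so a triangle covers at least
  \<open>3 * (k - i)\<close> elements of \<open>S\<close>.\<close>

lemma no_triangle:
  assumes "card S < 3 * (k - i)"
  shows "\<not> polygon J [A, B, C]"
proof
  assume "polygon J [A, B, C]"
  then have v: "vertex A" "vertex B" "vertex C"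
    and c: "card (A \<inter> B) = i" "card (B \<inter> C) = i" "card (C \<inter> A) = i"
    by (simp_all add: polygon_J_3_iff)
  note fin = v[THEN vertex_finite]
  have AB: "card (A \<union> B) + i = 2 * k"
    using card_Un_Int[of A B] fin v c by (simp add: vertex_def)
  have "(A \<union> B) \<inter> C = (B \<inter> C) \<union> (C \<inter> A)"
    by blast
  then have "card ((A \<union> B) \<inter> C) \<le> 2 * i"
    using card_Un_le[of "B \<inter> C" "C \<inter> A"] c by simp
  moreover have "card (A \<union> B) + card C = card (A \<union> B \<union> C) + card ((A \<union> B) \<inter> C)"
    using fin by (intro card_Un_Int) auto
  moreover have "card (A \<union> B \<union> C) \<le> card S"
    using v finite_S by (intro card_mono) (auto simp: vertex_def)
  ultimately show False
    using AB v assms by (auto simp: vertex_def)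
qed

text \<open>
  The opposite vertices \<open>A\<close> and \<open>C\<close> differ in one element. Their common neighbours are the sets
  \<open>P \<union> Y\<close> below; there is a choice for \<open>Y\<close> if \<open>i = 0\<close>, and for \<open>P\<close> if \<open>i > 0\<close>.
\<close>

lemma four_cycle:
  assumes "2 * k \<le> card S" "card S < 3 * (k - i)" "i = 0 \<Longrightarrow> 2 * k + 2 \<le> card S"
  shows "\<exists>xs. polygon J xs \<and> length xs = 4"
proof -
  have "k - 1 \<le> card S"
    using assms(1) by simp
  then obtain X where X: "X \<subseteq> S" "card X = k - 1" "finite X"
    using obtain_subset_with_card_n by blast
  have "2 \<le> card (S - X)"
    using X assms(1) i_less_k finite_S by (simp add: card_Diff_subset)
  then obtain T where T: "T \<subseteq> S - X" "card T = 2"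
    using obtain_subset_with_card_n by metis
  then obtain a c where ac: "a \<in> S" "c \<in> S" "a \<notin> X" "c \<notin> X" "a \<noteq> c"
    by (auto simp: card_2_iff)
  let ?A = "insert a X" and ?C = "insert c X"
  define R where "R = S - insert a (insert c X)"
  have "card R = card S - card (insert a (insert c X))"
    unfolding R_def using X ac finite_S by (intro card_Diff_subset) auto
  then have R: "card R = card S - (k + 1)"
    using X ac i_less_k by simp
  have "\<exists>P Q Y Z. P \<subseteq> X \<and> Q \<subseteq> X \<and> Y \<subseteq> R \<and> Z \<subseteq> R \<and> card P = i \<and> card Q = i \<and>
    card Y = k - i \<and> card Z = k - i \<and> (P \<noteq> Q \<or> Y \<noteq> Z)"
  proof (cases "i = 0")
    case True
    \<comment> \<open>The bound \<open>2 * k + 2 \<le> card S\<close> leaves at least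
      \<open>k + 1\<close> elements in \<open>R\<close>. With one element fewer in \<open>S\<close>,
      the set \<open>Y\<close> would be forced to be \<open>R\<close>.\<close>
    then have "0 < k" "k < card R"
      using R assms(3) i_less_k by simp_all
    then obtain Y Z where "Y \<subseteq> R" "Z \<subseteq> R" "card Y = k" "card Z = k" "Y \<noteq> Z"
      using obtain_two_subsets by metis
    then show ?thesis
      using True by (intro exI[of _ "{}"] exI[of _ Y] exI[of _ Z]) auto
  next
    case False
    \<comment> \<open>The two bounds on \<open>card S\<close> give \<open>3 * i < k\<close>, hence
      \<open>i < k - 1\<close> as \<open>i\<close> is positive. Moreover
      \<open>card R \<ge> k - 1 \<ge> k - i\<close>.\<close>
    then have "0 < i" "i < card X" "k - i \<le> card R"
      using X R assms(1,2) by simp_all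
    then obtain P Q Y where "P \<subseteq> X" "Q \<subseteq> X" "card P = i" "card Q = i" "P \<noteq> Q"
      and "Y \<subseteq> R" "card Y = k - i"
      using obtain_two_subsets[of i X] obtain_subset_with_card_n[of "k - i" R] by metis
    then show ?thesis
      by blast
  qed
  then obtain P Q Y Z where PQ: "P \<subseteq> X" "Q \<subseteq> X" "card P = i" "card Q = i"
    and YZ: "Y \<subseteq> R" "Z \<subseteq> R" "card Y = k - i" "card Z = k - i" and ne: "P \<noteq> Q \<or> Y \<noteq> Z"
    by blast
  let ?B = "P \<union> Y" and ?D = "Q \<union> Z"
  have RX: "R \<inter> ?A = {}" "R \<inter> ?C = {}" "R \<subseteq> S" "finite R"
    using finite_S by (auto simp: R_def)
  have fin: "finite P" "finite Q" "finite Y" "finite Z"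
    using PQ YZ X RX finite_subset by blast+
  have "card ?B = k" "card ?D = k"
    using PQ YZ RX fin i_less_k by (subst card_Un_disjoint; auto)+
  then have B: "vertex ?B" and D: "vertex ?D"
    using PQ YZ X RX by (auto simp: vertex_def)
  have A: "vertex ?A" and C: "vertex ?C"
    using X ac i_less_k by (auto simp: vertex_def)
  have "?A \<inter> ?B = P" "?B \<inter> ?C = P" "?C \<inter> ?D = Q" "?D \<inter> ?A = Q"
    using PQ YZ RX by blast+
  then have adj: "card (?A \<inter> ?B) = i" "card (?B \<inter> ?C) = i" "card (?C \<inter> ?D) = i" "card (?D \<inter> ?A) = i"
    using PQ by simp_all
  have "?A \<noteq> ?C"
    using ac by blast
  moreover have "?B \<noteq> ?D"
    using ne PQ YZ RX by blast
  ultimately have "polygon J [?A, ?B, ?C, ?D]"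
    unfolding polygon_J_4_iff using adj A B C D by blast
  then show ?thesis
    by (intro exI[of _ "[?A, ?B, ?C, ?D]"]) simp
qed

lemma girth_eq_3:
  assumes "2 * k \<le> card S" "3 * (k - i) \<le> card S"
  shows "girth J = 3"
proof -
  obtain xs where xs: "polygon J xs" "length xs = 3"
    using triangle assms by blast
  show ?thesis
    using girth_J_eqI[OF xs] by (simp add: numeral_eq_enat)
qed

lemma girth_eq_4:
  assumes "2 * k \<le> card S" "card S < 3 * (k - i)" "i = 0 \<Longrightarrow> 2 * k + 2 \<le> card S"
  shows "girth J = 4"
proof -
  obtain xs where xs: "polygon J xs" "length xs = 4"
    using four_cycle assms by blast
  have short: False if ys: "polygon J ys" "3 \<le> length ys" "length ys < 4" for ys
  proof -
    have "length ys = 3"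
      using ys(2,3) by simp
    then show False
      using ys(1) no_triangle assms(2) by (metis length_3_cases)
  qed
  show ?thesis
    using girth_J_eqI[OF xs _ short] by (simp add: numeral_eq_enat)
qed

end

section \<open>Odd graphs, that is, the Kneser graphs of \<open>k\<close>-subsets of a set of size
  \<open>2 * k + 1\<close>: girth 5 and 6\<close>

locale odd_graph = johnson S k 0 for S :: "'a set" and k +
  assumes card_S: "card S = 2 * k + 1"
begin

lemma arc_iff_disjoint: "(A, B) \<in> parcs J \<longleftrightarrow> vertex A \<and> vertex B \<and> A \<inter> B = {}"
  \<comment> \<open>Finiteness matters, since \<open>card\<close> is also 0 on infinite
    sets.\<close>
  using vertex_finite by (auto simp: arc_iff)

lemma card_Un_le_of_common_neighbour:
  assumes "vertex A" "vertex B" "vertex C" "A \<inter> B = {}" "B \<inter> C = {}"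
  shows "card (A \<union> C) \<le> k + 1"
proof -
  have "card (A \<union> C) \<le> card (S - B)"
    using assms finite_S by (intro card_mono) (auto simp: vertex_def)
  also have "\<dots> = k + 1"
    using assms card_S finite_S by (simp add: card_Diff_subset vertex_finite vertex_def)
  finally show ?thesis .
qed

lemma unique_common_neighbour:
  assumes "vertex A" "vertex B" "vertex C" "vertex D" "A \<noteq> C"
    and "A \<inter> B = {}" "B \<inter> C = {}" "C \<inter> D = {}" "D \<inter> A = {}"
  shows "B = D"
proof -
  note fin = assms(1-4)[THEN vertex_finite]
  have "card (B \<union> D) \<le> k"
  proof -
    have "\<not> C \<subseteq> A"
      using assms(1,3,5) fin by (metis card_subset_eq vertex_def)
    then have "A \<subset> A \<union> C"
      by blast
    then have "k < card (A \<union> C)"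
      using assms(1) fin psubset_card_mono[of "A \<union> C" A] by (simp add: vertex_def)
    moreover have "card (A \<union> C) + card (B \<union> D) = card ((A \<union> C) \<union> (B \<union> D))"
      using assms fin by (intro card_Un_disjoint[symmetric]) auto
    moreover have "\<dots> \<le> 2 * k + 1"
      unfolding card_S[symmetric] using assms finite_S by (intro card_mono) (auto simp: vertex_def)
    ultimately show ?thesis
      by linarith
  qed
  \<comment> \<open>Both sets have \<open>k\<close> elements and lie in a union of at most
    \<open>k\<close> elements.\<close>
  then have "B = B \<union> D" "D = B \<union> D"
    using assms fin by (intro card_seteq; auto simp: vertex_def)+
  then show ?thesis
    by simp
qed

lemma no_four_cycle: "\<not> polygon J [A, B, C, D]"
  using unique_common_neighbour[of A B C D] by (auto simp: polygon_def arc_iff_disjoint)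

lemma no_five_cycle:
  assumes "2 < k"
  shows "\<not> polygon J [A, B, C, D, E]"
proof
  assume "polygon J [A, B, C, D, E]"
  then have v: "vertex A" "vertex B" "vertex C" "vertex D" "vertex E"
    and d: "A \<inter> B = {}" "B \<inter> C = {}" "C \<inter> D = {}" "D \<inter> E = {}" "E \<inter> A = {}"
    by (auto simp: polygon_def arc_iff_disjoint)
  note fin = v[THEN vertex_finite]
  have "card (A \<union> C) \<le> k + 1" "card (C \<union> E) \<le> k + 1"
    using card_Un_le_of_common_neighbour v d by blast+
  moreover have "card A + card C = card (A \<union> C) + card (A \<inter> C)"
    "card C + card E = card (C \<union> E) + card (C \<inter> E)"
    using fin by (intro card_Un_Int; simp)+
  \<comment> \<open>The two intersections are disjoint because \<open>E \<inter> A = {}\<close>.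
    Each has at least \<open>k - 1\<close> elements, so \<open>2 * (k - 1) \<le> k\<close>.\<close>
  moreover have "card (A \<inter> C) + card (C \<inter> E) \<le> card C"
    using d fin by (subst card_Un_disjoint[symmetric]) (auto intro!: card_mono)
  ultimately show False
    using v assms by (simp add: vertex_def)
qed

text \<open>Set aside three elements and halve the remaining \<open>2 * (k - 1)\<close> into
  \<open>X\<close> and \<open>R\<close>. Adding one of the three to \<open>X\<close> and one to
  \<open>R\<close> gives disjoint sets exactly when the added elements differ. The six sets so
  obtained span \<open>K_{3,3}\<close> minus a perfect matching, which is a hexagon.\<close>

lemma six_cycle:
  assumes "1 < k"
  shows "\<exists>xs. polygon J xs \<and> length xs = 6"
proof -
  obtain T where T: "T \<subseteq> S" "card T = 3" "finite T"
    using obtain_subset_with_card_n[of 3 S] card_S assms by auto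
  then obtain a b c where abc: "T = {a, b, c}" "a \<noteq> b" "a \<noteq> c" "b \<noteq> c"
    by (auto simp: card_3_iff)
  have ST: "card (S - T) = 2 * (k - 1)"
    using T card_S by (simp add: card_Diff_subset)
  then obtain X where X: "X \<subseteq> S - T" "card X = k - 1" "finite X"
    using obtain_subset_with_card_n[of "k - 1" "S - T"] by auto
  define R where "R = S - T - X"
  have R: "R \<subseteq> S - T" "card R = k - 1" "finite R"
    using X ST finite_S by (auto simp: R_def card_Diff_subset)
  have XR: "X \<inter> R = {}"
    by (auto simp: R_def)
  \<comment> \<open>An element of \<open>X\<close> tells the two kinds of vertices apart. For
    \<open>k = 1\<close> both halves are empty and the six vertices collapse to three.\<close>
  have ne: "X \<noteq> {}"
    using X assms by auto
  have v: "vertex (insert t X)" "vertex (insert t R)" if "t \<in> T" for t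
    using that X R T assms by (auto simp: vertex_def card_insert_if)
  have inj: "insert s X \<noteq> insert t R" if "s \<in> T" "t \<in> T" for s t
  proof -
    obtain x where "x \<in> X"
      using ne by blast
    then have "x \<notin> insert t R"
      using that X XR by auto
    then show ?thesis
      using \<open>x \<in> X\<close> by auto
  qed
  have "insert a X \<noteq> insert b X" "insert a X \<noteq> insert c X" "insert b X \<noteq> insert c X"
    "insert a R \<noteq> insert b R" "insert a R \<noteq> insert c R" "insert b R \<noteq> insert c R"
    using abc X R by blast+
  moreover have "a \<notin> X" "b \<notin> X" "c \<notin> X" "a \<notin> R" "b \<notin> R" "c \<notin> R" "R \<inter> X = {}"
    using X R XR abc by blast+
  \<comment> \<open>The halves alternate, and opposite vertices carry the same added
    element.\<close>
  ultimately have "polygon J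
      [insert a X, insert c R, insert b X, insert a R, insert c X, insert b R]"
    using v inj inj[symmetric] abc XR by (simp add: polygon_def arc_iff_disjoint)
  then show ?thesis
    by (intro exI[of _ "[insert a X, insert c R, insert b X, insert a R, insert c X, insert b R]"]) simp
qed

text \<open>Arrange the five elements in a circle and run around it twice, cutting off two
  consecutive elements at a time.\<close>

lemma petersen_five_cycle:
  assumes "k = 2"
  shows "\<exists>xs. polygon J xs \<and> length xs = 5"
proof -
  obtain xs where "distinct xs" "set xs = S"
    using finite_S finite_distinct_list by blast
  moreover from this have "length xs = 5"
    using card_S assms distinct_card by fastforce
  ultimately obtain a b c d e where S: "S = {a, b, c, d, e}" "distinct [a, b, c, d, e]"
    by (metis length_5_cases list.simps(15) empty_set)
  then have "vertex {a, b}" "vertex {c, d}" "vertex {e, a}" "vertex {b, c}" "vertex {d, e}"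
    unfolding vertex_def using assms by auto
  then have "polygon J [{a, b}, {c, d}, {e, a}, {b, c}, {d, e}]"
    using S(2) by (auto simp: polygon_def arc_iff_disjoint doubleton_eq_iff)
  then show ?thesis
    by (intro exI[of _ "[{a, b}, {c, d}, {e, a}, {b, c}, {d, e}]"]) simp
qed

lemma polygon_length_ge_5:
  assumes "2 \<le> k" "polygon J xs" "3 \<le> length xs"
  shows "5 \<le> length xs"
proof -
  \<comment> \<open>The inequality \<open>2 * k + 1 < 3 * k\<close> holds from \<open>k = 2\<close>
    on.\<close>
  have "card S < 3 * (k - 0)"
    using assms(1) card_S by simp
  then have "length xs \<noteq> 3" "length xs \<noteq> 4"
    using assms(2) no_triangle no_four_cycle by (metis length_3_cases length_4_cases)+
  then show ?thesis
    using assms(3) by linarith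
qed

lemma girth_eq_5:
  assumes "k = 2"
  shows "girth J = 5"
proof -
  obtain xs where xs: "polygon J xs" "length xs = 5"
    using petersen_five_cycle assms by blast
  have short: False if "polygon J ys" "3 \<le> length ys" "length ys < 5" for ys
    using polygon_length_ge_5[of ys] that assms by simp
  show ?thesis
    using girth_J_eqI[OF xs _ short] by (simp add: numeral_eq_enat)
qed

lemma girth_eq_6:
  assumes "2 < k"
  shows "girth J = 6"
proof -
  obtain xs where xs: "polygon J xs" "length xs = 6"
    using six_cycle assms by auto
  have short: False if ys: "polygon J ys" "3 \<le> length ys" "length ys < 6" for ys
  proof -
    have "length ys = 5"
      using polygon_length_ge_5[of ys] ys assms by simp
    then show False
      using ys(1) no_five_cycle[OF assms] by (metis length_5_cases)
  qed
  show ?thesis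
    using girth_J_eqI[OF xs _ short] by (simp add: numeral_eq_enat)
qed

end

theorem theorem2p4:
  fixes S :: "'a set" and v k i :: nat
  assumes "finite S" and "card S = v"
    and "v > k" and "k > i"
    and "v \<ge> 2 * k" and "(v, k, i) \<noteq> (2 * k, k, 0)"
  shows "(v \<ge> 3 * (k - i) \<longrightarrow> girth (generalized_johnson_graph S k i) = 3) \<and>
    (v < 3 * (k - i) \<and> (v, k, i) \<noteq> (2 * k + 1, k, 0) \<longrightarrow> girth (generalized_johnson_graph S k i) = 4) \<and>
    ((v, k, i) = (5, 2, 0) \<longrightarrow> girth (generalized_johnson_graph S k i) = 5) \<and>
    ((v, k, i) = (2 * k + 1, k, 0) \<and> k > 2 \<longrightarrow> girth (generalized_johnson_graph S k i) = 6)"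
proof -
  interpret johnson S k i
    using assms by unfold_locales
  have odd: "odd_graph S k" if "v = 2 * k + 1" "i = 0"
    using that assms by unfold_locales auto
  have "girth J = 3" if "v \<ge> 3 * (k - i)"
    using girth_eq_3 that assms by simp
  \<comment> \<open>For \<open>i = 0\<close> the values \<open>2 * k\<close> and
    \<open>2 * k + 1\<close> of \<open>v\<close> are both excluded, so
    \<open>v \<ge> 2 * k + 2\<close>, as the 4-cycle requires.\<close>
  moreover have "girth J = 4" if "v < 3 * (k - i)" "(v, k, i) \<noteq> (2 * k + 1, k, 0)"
    using that assms by (intro girth_eq_4) auto
  moreover have "girth J = 5" if "(v, k, i) = (5, 2, 0)"
    using odd_graph.girth_eq_5[of S k] odd that by simp
  moreover have "girth J = 6" if "(v, k, i) = (2 * k + 1, k, 0)" "k > 2"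
    using odd_graph.girth_eq_6[of S k] odd that by simp
  ultimately show ?thesis
    by blast
qed

end
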